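(* Let $Q=(q_0,q_1)\in(1,\infty)^2$ satisfy $q_0+q_1>q_0q_1$. Then Lebesgue almost every $x\in I_Q=\left[0,\frac{1}{q_1-1}\right]$ has a continuum (i.e. $2^{\aleph_0}$) of $Q$-expansions.
   Context: For $Q=(q_0,q_1)\in(1,\infty)^2$, a $Q$-expansion of a real number $x$ is a sequence $(c_i)_{i\ge1}\in\{0,1\}^\infty$ such that $$x=\sum_{i=1}^{\infty}\frac{c_i}{q_{c_1}q_{c_2}\cdots q_{c_i}},$$ where $q_{c_j}$ equals $q_0$ if $c_j=0$ and $q_1$ if $c_j=1$. *)

theory Defs
  imports "HOL-Analysis.Analysis"
begin

definition qbase :: "real \<times> real \<Rightarrow> nat \<Rightarrow> real" where
  "qbase Q d = (if d = 0 then fst Q else snd Q)"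

(* Digit sequences are indexed from 0: c i is the digit usually written with index i + 1.
   Hence the product runs over all j up to and including i. *)
definition is_Q_expansion :: "real \<times> real \<Rightarrow> real \<Rightarrow> (nat \<Rightarrow> nat) \<Rightarrow> bool" where
  "is_Q_expansion Q x c \<longleftrightarrow>
     (\<forall>i. c i \<in> {0, 1}) \<and>
     (\<lambda>i. real (c i) / (\<Prod>j\<le>i. qbase Q (c j))) sums x"

definition Q_expansions :: "real \<times> real \<Rightarrow> real \<Rightarrow> (nat \<Rightarrow> nat) set" where
  "Q_expansions Q x = {c. is_Q_expansion Q x c}"

definition I_Q :: "real \<times> real \<Rightarrow> real set" where
  "I_Q Q = {0 .. 1 / (snd Q - 1)}"

end

theory Submission
  imports Defs
begin

text \<open>
  Write \<open>I = [0, 1/(q1 - 1)]\<close>. Prescribing the digit \<open>d\<close> sends \<open>x\<close> to \<open>q\<^sub>d x - d\<close>, and a digit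
  sequence is an expansion of \<open>x\<close> exactly when the orbit of \<open>x\<close> under the maps that it selects stays
  in \<open>I\<close> (\<open>is_expansion_iff_orbit\<close>). The condition \<open>q0 q1 < q0 + q1\<close> says that the two cylinders of
  level one, \<open>[0, 1/(q0 (q1 - 1))]\<close> and \<open>[1/q1, 1/(q1 - 1)]\<close>, cover \<open>I\<close> and overlap in a
  nondegenerate interval, the switch region. Every point of \<open>I\<close> then has an expansion, and a point
  whose orbit meets the switch region has two, since both digits may be used there.

  Consequently the set of points with a unique expansion has holes at all scales. Around such a
  point the cylinders of its expansion shrink to it, at each step by at most the factor
  \<open>max q0 q1\<close>, and each contains an affine copy of the switch region, a fixed proportion of its
  length, on which expansions are not unique. A set with this porosity is negligible
  (\<open>negligible_uniformly_porous\<close>, \<open>negligible_univoque\<close>).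

  The points some orbit of which reaches a point with a unique expansion form a countable union of
  affine copies of this set, again negligible. For any other \<open>x\<close>, an expansion may be
  changed after any finite prefix, so the set of expansions has no isolated point. It is also closed
  in the Cantor space of digit sequences (\<open>expansions_perfect\<close>), and a nonempty perfect set there has
  the cardinality of the continuum.
\<close>

section \<open>Uniformly porous sets are negligible\<close>

text \<open>
  The closure \<open>C\<close> of a porous set has the same gaps and is measurable. Cover \<open>C\<close> by nonoverlapping
  intervals of total length at most \<open>\<mu> C + e\<close>. As each of them loses at least the proportion \<open>\<delta>\<close> to a gap,
  \<open>\<mu> C \<le> (1 - \<delta>) (\<mu> C + e)\<close> for all \<open>e > 0\<close>, so \<open>\<mu> C = 0\<close>.
\<close>

lemma negligible_uniformly_porous:
  fixes S :: "real set"
  assumes S: "S \<subseteq> {a..b}" and "\<delta> > 0"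
    and gap: "\<And>c d. \<lbrakk>c < d; {c..d} \<subseteq> {a..b}\<rbrakk> \<Longrightarrow>
           \<exists>u v. c \<le> u \<and> v \<le> d \<and> \<delta> * (d - c) \<le> v - u \<and> {u<..<v} \<inter> S = {}"
  shows "negligible S"
proof -
  define C where "C = closure S"
  have C: "C \<subseteq> cbox a b"
    using S closure_minimal[of S "{a..b}"] by (simp add: C_def)
  then have C_lm: "C \<in> lmeasurable"
    unfolding C_def by (meson bounded_cbox bounded_subset closed_closure compact_eq_bounded_closed lmeasurable_compact)
  have small: "measure lebesgue (C \<inter> {c<..<d}) \<le> (1 - \<delta>) * measure lebesgue {c<..<d}"
    if cd: "c < d" "{c..d} \<subseteq> {a..b}" for c d
  proof -
    obtain u v where uv: "c \<le> u" "v \<le> d" "\<delta> * (d - c) \<le> v - u" "{u<..<v} \<inter> S = {}"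
      using gap[OF cd] by blast
    have "0 < \<delta> * (d - c)"
      using \<open>\<delta> > 0\<close> cd by simp
    then have "u < v"
      using uv by linarith
    have "{u<..<v} \<inter> C = {}"
      using uv(4) unfolding C_def by (simp add: open_Int_closure_eq_empty)
    then have "C \<inter> {c<..<d} \<subseteq> {c<..<d} - {u<..<v}"
      by blast
    then have "measure lebesgue (C \<inter> {c<..<d}) \<le> measure lebesgue ({c<..<d} - {u<..<v})"
      using C_lm by (intro measure_mono_fmeasurable fmeasurable.Diff fmeasurableD) auto
    also have "\<dots> = (d - c) - (v - u)"
      using uv \<open>u < v\<close> \<open>c < d\<close>
      by (subst measurable_measure_Diff) (auto simp: fmeasurableD)
    finally show ?thesis
      using uv(3) \<open>c < d\<close> by (simp add: algebra_simps)
  qed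
  have le: "measure lebesgue C \<le> (1 - \<delta>) * (measure lebesgue C + e)" if "e > 0" and "a < b" for e
  proof -
    have "\<delta> \<le> 1"
    proof -
      obtain u v where "a \<le> u" "v \<le> b" "\<delta> * (b - a) \<le> v - u"
        using gap[OF \<open>a < b\<close>] by blast
      then have "\<delta> * (b - a) \<le> 1 * (b - a)"
        by simp
      then show ?thesis
        using \<open>a < b\<close> mult_le_cancel_right[of \<delta> "b - a" 1] by simp
    qed
    obtain \<D> where \<D>: "countable \<D>"
        "\<And>K. K \<in> \<D> \<Longrightarrow> K \<subseteq> cbox a b \<and> K \<noteq> {} \<and> (\<exists>c d. K = cbox c d)"
        "pairwise (\<lambda>A B. interior A \<inter> interior B = {}) \<D>"
        "C \<subseteq> \<Union>\<D>" "\<Union>\<D> \<in> lmeasurable" "measure lebesgue (\<Union>\<D>) \<le> measure lebesgue C + e"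
      using measurable_outer_intervals_bounded[OF C_lm C \<open>e > 0\<close>] by metis
    \<comment> \<open>Interiors are genuinely disjoint, so that measures add up; the endpoints that they miss are
        negligible.\<close>
    define T where "T = (\<Union>K\<in>\<D>. interior K)"
    have T: "T \<in> lmeasurable" "T \<subseteq> \<Union>\<D>"
    proof -
      show "T \<subseteq> \<Union>\<D>"
        using interior_subset unfolding T_def by blast
      then have "T \<subseteq> cbox a b"
        using \<D>(2) by blast
      moreover have "open T"
        by (auto simp: T_def)
      ultimately show "T \<in> lmeasurable"
        by (meson bounded_cbox bounded_subset lmeasurable_open)
    qed
    have "negligible (\<Union>K\<in>\<D>. K - interior K)"
    proof (intro negligible_countable_Union countable_image \<D>(1), clarify)
      fix K assume "K \<in> \<D>"
      then obtain c d where "K = cbox c d"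
        using \<D>(2) by blast
      then show "negligible (K - interior K)"
        using negligible_frontier_interval[of c d] by (simp only: interior_cbox)
    qed
    moreover have "C - T \<subseteq> (\<Union>K\<in>\<D>. K - interior K)"
      using \<D>(4) by (auto simp: T_def)
    ultimately have "negligible (C - T)"
      by (rule negligible_subset)
    then have "measure lebesgue C = measure lebesgue (C \<inter> T)"
      by (intro measure_negligible_symdiff[symmetric])
         (use C_lm T in \<open>auto simp: Un_Diff Diff_Int intro: negligible_subset\<close>)
    moreover have "measure lebesgue (C \<inter> T) \<le> (1 - \<delta>) * measure lebesgue T"
    proof -
      have disj: "disjoint_family_on interior \<D>"
        using \<D>(3) by (auto simp: disjoint_family_on_def pairwise_def)
      have piece: "emeasure lebesgue (C \<inter> interior K) \<le> ennreal (1 - \<delta>) * emeasure lebesgue (interior K)"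
        if K_in: "K \<in> \<D>" for K
      proof (cases "interior K = {}")
        case False
        obtain c d where K: "K = {c..d}" "K \<subseteq> {a..b}"
          using \<D>(2)[OF K_in] by (metis cbox_interval)
        then have int: "interior K = {c<..<d}" "c < d"
          using False by (auto simp: interior_atLeastAtMost_real)
        have "C \<inter> {c<..<d} \<in> lmeasurable"
          using C_lm by (simp add: fmeasurable_Int_fmeasurable)
        then have "emeasure lebesgue (C \<inter> {c<..<d}) = ennreal (measure lebesgue (C \<inter> {c<..<d}))"
          by (simp add: emeasure_eq_measure2)
        also have "\<dots> \<le> ennreal ((1 - \<delta>) * measure lebesgue {c<..<d})"
          using small[of c d] int K by (intro ennreal_leI) auto
        also have "\<dots> = ennreal (1 - \<delta>) * emeasure lebesgue {c<..<d}"
          using \<open>\<delta> \<le> 1\<close> int(2) by (simp add: ennreal_mult)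
        finally show ?thesis
          by (simp add: int)
      qed simp
      have "C \<inter> T = (\<Union>K\<in>\<D>. C \<inter> interior K)"
        by (auto simp: T_def)
      then have "emeasure lebesgue (C \<inter> T) = (\<integral>\<^sup>+K. emeasure lebesgue (C \<inter> interior K) \<partial>count_space \<D>)"
        using C_lm disj \<D>(1) by (simp only:, intro emeasure_UN_countable) (auto simp: disjoint_family_on_def)
      also have "\<dots> \<le> (\<integral>\<^sup>+K. ennreal (1 - \<delta>) * emeasure lebesgue (interior K) \<partial>count_space \<D>)"
        using piece by (intro nn_integral_mono) auto
      also have "\<dots> = ennreal (1 - \<delta>) * emeasure lebesgue T"
        unfolding T_def using disj \<D>(1) by (subst emeasure_UN_countable) (auto simp: nn_integral_cmult)
      also have "\<dots> = ennreal ((1 - \<delta>) * measure lebesgue T)"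
        using T \<open>\<delta> \<le> 1\<close> by (simp add: ennreal_mult emeasure_eq_measure2)
      finally show ?thesis
        using C_lm T \<open>\<delta> \<le> 1\<close> by (simp add: emeasure_eq_measure2 fmeasurable_Int_fmeasurable fmeasurableD)
    qed
    moreover have "measure lebesgue T \<le> measure lebesgue (\<Union>\<D>)"
      using T \<D>(5) by (intro measure_mono_fmeasurable) auto
    then have "measure lebesgue T \<le> measure lebesgue C + e"
      using \<D>(6) by linarith
    then have "(1 - \<delta>) * measure lebesgue T \<le> (1 - \<delta>) * (measure lebesgue C + e)"
      using \<open>\<delta> \<le> 1\<close> by (intro mult_left_mono) auto
    ultimately show ?thesis
      by linarith
  qed
  have "\<delta> * measure lebesgue C \<le> 0"
  proof (cases "a < b")
    case True
    show ?thesis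
    proof (rule field_le_epsilon)
      fix e :: real assume "e > 0"
      then have "0 \<le> \<delta> * e"
        using \<open>\<delta> > 0\<close> by simp
      then show "\<delta> * measure lebesgue C \<le> 0 + e"
        using le[OF \<open>e > 0\<close> True] by (simp add: algebra_simps)
    qed
  next
    case False
    have "measure lebesgue C \<le> measure lebesgue {a..b}"
      using C C_lm by (intro measure_mono_fmeasurable fmeasurableD) auto
    then show ?thesis
      using False \<open>\<delta> > 0\<close> by (simp add: mult_le_0_iff split: if_splits)
  qed
  then have "measure lebesgue C = 0"
    using \<open>\<delta> > 0\<close> by (simp add: mult_le_0_iff antisym)
  then have "negligible C"
    using C_lm negligible_iff_measure by blast
  then show ?thesis
    unfolding C_def by (meson closure_subset negligible_subset)
qed

section \<open>Expansions and orbits\<close>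

locale overlapping_bases =
  fixes q0 q1 :: real
  assumes q0: "q0 > 1" and q1: "q1 > 1" and overlap: "q0 + q1 > q0 * q1"
begin

abbreviation q :: "nat \<Rightarrow> real" where "q \<equiv> qbase (q0, q1)"

abbreviation is_expansion :: "real \<Rightarrow> (nat \<Rightarrow> nat) \<Rightarrow> bool" where
  "is_expansion \<equiv> is_Q_expansion (q0, q1)"

text \<open>
  The right endpoint of the interval \<open>I_Q\<close>, equivalently its length. It is the value of the constant
  digit sequence \<open>1\<close>, that is, the fixed point of \<open>x \<mapsto> q1 x - 1\<close>.
\<close>

definition len :: real where "len = 1 / (q1 - 1)"

lemma len_pos: "len > 0"
  using q1 by (simp add: len_def)

lemma len_eq: "1 + len = q1 * len"
  using q1 by (simp add: len_def field_simps)

lemma q_simps [simp]: "q 0 = q0" "q (Suc 0) = q1" "q 1 = q1"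
  by (simp_all add: qbase_def)

lemma q_pos [simp]: "q d > 0"
  using q0 q1 by (simp add: qbase_def)

lemma q_nonzero [simp]: "q d \<noteq> 0"
  using q_pos[of d] by linarith

primrec orbit :: "(nat \<Rightarrow> nat) \<Rightarrow> nat \<Rightarrow> real \<Rightarrow> real" where
  "orbit c 0 x = x"
| "orbit c (Suc n) x = q (c n) * orbit c n x - real (c n)"

text \<open>The factor by which the first \<open>n\<close> digits of \<open>c\<close> expand distances.\<close>

definition scale :: "(nat \<Rightarrow> nat) \<Rightarrow> nat \<Rightarrow> real" where
  "scale c n = (\<Prod>j<n. q (c j))"

lemma scale_simps [simp]: "scale c 0 = 1" "scale c (Suc n) = q (c n) * scale c n"
  by (simp_all add: scale_def mult.commute)

lemma scale_pos [simp]: "scale c n > 0"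
  by (simp add: scale_def prod_pos)

lemma scale_nonzero [simp]: "scale c n \<noteq> 0"
  using scale_pos[of c n] by linarith

lemma scale_ge_power: "min q0 q1 ^ n \<le> scale c n"
  using q0 q1 by (induction n) (auto intro!: mult_mono simp: qbase_def less_imp_le)

lemma inverse_scale_tendsto_0: "(\<lambda>n. a / scale c n) \<longlonglongrightarrow> 0"
proof -
  have "filterlim (\<lambda>n. min q0 q1 ^ n) at_top sequentially"
    using q0 q1
    by (intro filterlim_at_infinity_imp_filterlim_at_top filterlim_realpow_sequentially_gt1)
       (auto intro!: always_eventually zero_less_power)
  then have "filterlim (scale c) at_top sequentially"
    by (rule filterlim_at_top_mono) (simp add: scale_ge_power)
  then show ?thesis
    by (rule real_tendsto_divide_at_top[OF tendsto_const])
qed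

lemma orbit_eq_sum:
  "orbit c n x = scale c n * (x - (\<Sum>i<n. real (c i) / (\<Prod>j\<le>i. q (c j))))"
proof (induction n)
  case (Suc n)
  have "(\<Prod>j\<le>n. q (c j)) = q (c n) * scale c n"
    using scale_simps(2)[of c n] by (simp add: scale_def lessThan_Suc_atMost)
  then show ?case
    by (simp add: Suc algebra_simps)
qed simp

lemma orbit_diff: "orbit c n y - orbit c n x = scale c n * (y - x)"
  by (simp add: orbit_eq_sum algebra_simps)

lemma orbit_cong: "(\<And>i. i < n \<Longrightarrow> c i = d i) \<Longrightarrow> orbit c n x = orbit d n x"
  by (induction n) auto

lemma orbit_add: "orbit c (m + n) x = orbit (\<lambda>i. c (m + i)) n (orbit c m x)"
  by (induction n) auto

lemma digit_add_len_le:
  assumes "d \<in> {0, 1}"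
  shows "real d + len \<le> q d * len"
proof -
  have "1 * len \<le> q0 * len"
    using q0 len_pos by (intro mult_right_mono) auto
  then show ?thesis
    using assms len_eq by auto
qed

text \<open>
  The inverse branches \<open>y \<mapsto> (y + d) / q\<^sub>d\<close> map \<open>[0, len]\<close> into itself; an orbit that has left the
  interval therefore never comes back.
\<close>

lemma branch_in_interval:
  assumes "d \<in> {0, 1}" and "q d * y - real d \<in> {0..len}"
  shows "y \<in> {0..len}"
proof -
  have "0 \<le> q d * y - real d" "q d * y - real d \<le> len"
    using assms(2) by simp_all
  then have "q d * 0 \<le> q d * y" "q d * y \<le> q d * len"
    using digit_add_len_le[OF assms(1)] by linarith+
  then have "0 \<le> y" "y \<le> len"
    by (simp_all only: mult_le_cancel_left_pos[OF q_pos])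
  then show ?thesis
    by simp
qed

lemma orbit_in_interval_downward:
  assumes "\<And>i. c i \<in> {0, 1}" and "orbit c n x \<in> {0..len}" and "m \<le> n"
  shows "orbit c m x \<in> {0..len}"
  using assms(3,2)
proof (induction n rule: dec_induct)
  case (step n)
  then show ?case
    using branch_in_interval[OF assms(1)] by simp
qed

text \<open>
  With \<open>A n\<close> the partial sums, \<open>orbit c n x\<close> lies in \<open>[0, len]\<close> iff \<open>x\<close> lies in the cylinder
  \<open>[A n, A n + len / scale c n]\<close>. The cylinders are nested and their lengths tend to \<open>0\<close>, so \<open>x\<close> is
  the sum of the series iff it lies in all of them. This replaces statements about infinite sums by
  conditions each of which involves finitely many digits only.
\<close>

lemma is_expansion_iff_orbit:
  "is_expansion x c \<longleftrightarrow> (\<forall>i. c i \<in> {0, 1}) \<and> (\<forall>n. orbit c n x \<in> {0..len})"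
proof (cases "\<forall>i. c i \<in> {0, 1}")
  case digits: True
  define A where "A n = (\<Sum>i<n. real (c i) / (\<Prod>j\<le>i. q (c j)))" for n
  have sums_iff: "is_expansion x c \<longleftrightarrow> A \<longlonglongrightarrow> x"
    using digits by (simp add: is_Q_expansion_def sums_def A_def[abs_def])
  have A_Suc: "A (Suc n) = A n + real (c n) / scale c (Suc n)" for n
    by (simp add: A_def scale_def lessThan_Suc_atMost del: scale_simps flip: lessThan_Suc_atMost)
  have orbit_A: "orbit c n x = scale c n * (x - A n)" for n
    by (simp add: orbit_eq_sum A_def)
  have orbit_iff: "orbit c n x \<in> {0..len} \<longleftrightarrow> A n \<le> x \<and> x \<le> A n + len / scale c n" for n
    unfolding orbit_A using scale_pos[of c n]
    by (auto simp: zero_le_mult_iff field_simps not_le[symmetric])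
  show ?thesis
  proof
    assume "is_expansion x c"
    then have lim: "A \<longlonglongrightarrow> x"
      by (simp add: sums_iff)
    have "incseq A"
      using scale_pos[of c] by (intro incseq_SucI) (simp add: A_Suc less_imp_le)
    then have lower: "A n \<le> x" for n
      using lim by (rule incseq_le)
    have "A (Suc n) + len / scale c (Suc n) \<le> A n + len / scale c n" for n
    proof -
      have "c n \<in> {0, 1}"
        using digits by blast
      then have "real (c n) + len \<le> q (c n) * len"
        by (rule digit_add_len_le)
      then have "(real (c n) + len) / scale c (Suc n) \<le> q (c n) * len / scale c (Suc n)"
        using scale_pos[of c "Suc n"] by (intro divide_right_mono) linarith+
      also have "\<dots> = len / scale c n"
        by simp
      finally show ?thesis
        unfolding A_Suc add_divide_distrib by linarith
    qed
    then have "decseq (\<lambda>n. A n + len / scale c n)"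
      by (rule decseq_SucI)
    moreover have "(\<lambda>n. A n + len / scale c n) \<longlonglongrightarrow> x"
      using tendsto_add[OF lim inverse_scale_tendsto_0[of len c]] by simp
    ultimately have upper: "x \<le> A n + len / scale c n" for n
      by (rule decseq_ge)
    show "(\<forall>i. c i \<in> {0, 1}) \<and> (\<forall>n. orbit c n x \<in> {0..len})"
      using digits orbit_iff lower upper by blast
  next
    assume "(\<forall>i. c i \<in> {0, 1}) \<and> (\<forall>n. orbit c n x \<in> {0..len})"
    then have bounds: "A n \<le> x \<and> x \<le> A n + len / scale c n" for n
      using orbit_iff by blast
    have "(\<lambda>n. x - len / scale c n) \<longlonglongrightarrow> x"
      using tendsto_diff[OF tendsto_const inverse_scale_tendsto_0[of len c]] by simp
    moreover have "\<forall>\<^sub>F n in sequentially. x - len / scale c n \<le> A n"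
      using bounds by (intro always_eventually allI) (simp add: diff_le_eq)
    moreover have "\<forall>\<^sub>F n in sequentially. A n \<le> x"
      using bounds by simp
    ultimately have "A \<longlonglongrightarrow> x"
      by (rule tendsto_sandwich[OF _ _ _ tendsto_const, rotated 2])
    then show "is_expansion x c"
      by (simp add: sums_iff)
  qed
qed (use is_Q_expansion_def in blast)

lemma is_expansion_drop:
  assumes "is_expansion x c"
  shows "is_expansion (orbit c n x) (\<lambda>i. c (n + i))"
  using assms by (simp add: is_expansion_iff_orbit flip: orbit_add)

definition splice :: "(nat \<Rightarrow> nat) \<Rightarrow> nat \<Rightarrow> (nat \<Rightarrow> nat) \<Rightarrow> nat \<Rightarrow> nat" where
  "splice c n d = (\<lambda>i. if i < n then c i else d (i - n))"

lemma splice_simps [simp]: "i < n \<Longrightarrow> splice c n d i = c i" "splice c n d (n + i) = d i"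
  by (simp_all add: splice_def)

lemma splice_inject: "splice c n d = splice c n d' \<longleftrightarrow> d = d'"
  by (metis ext splice_simps(2))

lemma is_expansion_splice:
  assumes "\<And>i. c i \<in> {0, 1}" and d: "is_expansion (orbit c n x) d"
  shows "is_expansion x (splice c n d)"
proof -
  have digits: "splice c n d i \<in> {0, 1}" for i
    using assms(1)[of i] d by (simp add: is_expansion_iff_orbit splice_def)
  have "orbit (splice c n d) (n + m) x \<in> {0..len}" for m
    using d orbit_cong[of n "splice c n d" c x]
    by (simp add: orbit_add is_expansion_iff_orbit)
  then have "orbit (splice c n d) m x \<in> {0..len}" for m
    using orbit_in_interval_downward[OF digits, where n = "n + m" and x = x and m = m] by simp
  with digits show ?thesis
    by (simp add: is_expansion_iff_orbit)
qed

text \<open>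
  The two cylinders of level one cover the interval: if the digit \<open>0\<close> leads out of it, then \<open>y\<close> lies
  to the right of the switch region, where the digit \<open>1\<close> is possible.
\<close>

lemma ex_digit_step:
  assumes "y \<in> {0..len}"
  shows "\<exists>d \<in> {0, 1}. q d * y - real d \<in> {0..len}"
proof (cases "q0 * y \<le> len")
  case True
  then show ?thesis
    using assms q0 by (intro bexI[of _ 0]) auto
next
  case False
  have "q0 \<le> q1 * len"
    using overlap q1 by (simp add: len_def field_simps)
  also have "q1 * len \<le> q1 * (q0 * y)"
    using False q1 by (intro mult_left_mono) auto
  finally have "q0 * 1 \<le> q0 * (q1 * y)"
    by (simp add: mult.left_commute)
  then have "1 \<le> q1 * y"
    using q0 by simp
  moreover have "q1 * y \<le> q1 * len"
    using assms q1 by simp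
  ultimately show ?thesis
    using len_eq by (intro bexI[of _ 1]) auto
qed

lemma ex_expansion:
  assumes x: "x \<in> {0..len}"
  shows "\<exists>c. is_expansion x c"
proof -
  obtain g where g: "\<And>y. y \<in> {0..len} \<Longrightarrow> g y \<in> {0, 1::nat} \<and> q (g y) * y - real (g y) \<in> {0..len}"
    using bchoice[of "{0..len}"] ex_digit_step by (metis (no_types, lifting))
  define s where "s = rec_nat x (\<lambda>_ y. q (g y) * y - real (g y))"
  have s_Suc: "s (Suc n) = q (g (s n)) * s n - real (g (s n))" for n
    by (simp add: s_def)
  have s_in: "s n \<in> {0..len}" for n
  proof (induction n)
    case (Suc n)
    then show ?case
      unfolding s_Suc using g by blast
  qed (use x in \<open>simp add: s_def\<close>)
  have "orbit (\<lambda>n. g (s n)) n x = s n" for n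
    by (induction n) (simp add: s_def, simp add: s_Suc)
  then have "is_expansion x (\<lambda>n. g (s n))"
    using s_in g by (simp add: is_expansion_iff_orbit)
  then show ?thesis
    by blast
qed

section \<open>Points with a unique expansion\<close>

definition univoque :: "real set" where
  "univoque = {x. \<exists>!c. is_expansion x c}"

text \<open>
  The switch region \<open>[1 / q1, len / q0]\<close> is the intersection of the two cylinders of level one: at a
  point of it either digit can be chosen, and each choice extends to an expansion.
\<close>

lemma switch_not_univoque:
  assumes "\<And>i. c i \<in> {0, 1}" and "orbit c n x \<in> {1 / q1 .. len / q0}"
  shows "x \<notin> univoque"
proof
  let ?y = "orbit c n x"
  assume "x \<in> univoque"
  have "q0 * ?y - real 0 \<in> {0..len}" "q1 * ?y - real 1 \<in> {0..len}"
  proof -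
    have y: "1 \<le> q1 * ?y" "q0 * ?y \<le> len"
      using assms(2) q0 q1 by (auto simp: field_simps)
    then have "?y \<ge> 0"
      using q1 by (smt (verit) mult_nonneg_nonpos)
    moreover have "?y \<le> len"
      using y q0 \<open>?y \<ge> 0\<close> by (smt (verit) mult_le_cancel_right1)
    then have "q1 * ?y \<le> q1 * len"
      using q1 by simp
    ultimately show "q0 * ?y - real 0 \<in> {0..len}" "q1 * ?y - real 1 \<in> {0..len}"
      using y q0 len_eq by auto
  qed
  then obtain d0 d1 where "is_expansion (q0 * ?y - real 0) d0" "is_expansion (q1 * ?y - real 1) d1"
    using ex_expansion by blast
  then have d: "is_expansion ?y (splice (\<lambda>_. 0) 1 d0)" "is_expansion ?y (splice (\<lambda>_. 1) 1 d1)"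
    by (auto intro!: is_expansion_splice)
  have "splice (\<lambda>_. 0) 1 d0 0 \<noteq> splice (\<lambda>_. 1) 1 d1 0"
    by simp
  then have "splice c n (splice (\<lambda>_. 0) 1 d0) \<noteq> splice c n (splice (\<lambda>_. 1) 1 d1)"
    by (metis splice_inject)
  moreover have "is_expansion x (splice c n (splice (\<lambda>_. 0) 1 d0))"
      "is_expansion x (splice c n (splice (\<lambda>_. 1) 1 d1))"
    using d is_expansion_splice[OF assms(1)] by auto
  ultimately show False
    using \<open>x \<in> univoque\<close> by (auto simp: univoque_def)
qed

text \<open>
  Porosity: let \<open>[a, b]\<close> be a subinterval, with midpoint \<open>m\<close>. If there is no univoque point in its
  middle half, that half is a gap. Otherwise let \<open>x\<close> be such a point and take the first cylinder of
  its expansion that is shorter than a quarter of \<open>[a, b]\<close>. The cylinder lies in \<open>[a, b]\<close>, and its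
  length is comparable to \<open>b - a\<close> because one more digit shortens a cylinder by at most \<open>max q0 q1\<close>.
  The part of it that is mapped onto the switch region is the gap.
\<close>

lemma negligible_univoque: "negligible univoque"
proof -
  define s where "s = len / q0 - 1 / q1"
  define qm where "qm = max q0 q1"
  have "s > 0"
    using overlap q0 q1 by (simp add: s_def len_def field_simps)
  have "qm > 1"
    using q0 by (simp add: qm_def)
  have "s \<le> len"
  proof -
    have "len / q0 \<le> len / 1"
      using q0 len_pos by (intro divide_left_mono) auto
    then show ?thesis
      using q1 by (simp add: s_def) (smt (verit) divide_pos_pos)
  qed
  define \<delta> where "\<delta> = s / (4 * qm * len)"
  have "\<delta> > 0"
    using \<open>s > 0\<close> \<open>qm > 1\<close> len_pos by (simp add: \<delta>_def)
  have "\<delta> \<le> 1 / 2"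
  proof -
    have "s \<le> qm * len"
      using \<open>s \<le> len\<close> \<open>qm > 1\<close> len_pos by (smt (verit) mult_le_cancel_right1)
    then have "s \<le> 2 * (qm * len)"
      using \<open>s > 0\<close> by linarith
    then show ?thesis
      using \<open>qm > 1\<close> len_pos by (simp add: \<delta>_def divide_simps)
  qed
  show ?thesis
  proof (rule negligible_uniformly_porous[of _ 0 len \<delta>])
    show "univoque \<subseteq> {0..len}"
    proof
      fix x assume "x \<in> univoque"
      then obtain c where "is_expansion x c"
        by (auto simp: univoque_def)
      then show "x \<in> {0..len}"
        using is_expansion_iff_orbit orbit.simps(1) by metis
    qed
    show "\<delta> > 0" by fact
    fix a b :: real assume ab: "a < b" "{a..b} \<subseteq> {0..len}"
    define m r where "m = (a + b) / 2" and "r = (b - a) / 4"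
    show "\<exists>u v. a \<le> u \<and> v \<le> b \<and> \<delta> * (b - a) \<le> v - u \<and> {u<..<v} \<inter> univoque = {}"
    proof (cases "{m - r<..<m + r} \<inter> univoque = {}")
      case True
      have "\<delta> * (b - a) \<le> 1 / 2 * (b - a)"
        using \<open>\<delta> \<le> 1 / 2\<close> ab by (intro mult_right_mono) auto
      then show ?thesis
        using True ab by (intro exI[of _ "m - r"] exI[of _ "m + r"]) (auto simp: m_def r_def field_simps)
    next
      case False
      then obtain x where x: "x \<in> univoque" "m - r < x" "x < m + r"
        by auto
      then obtain c where c: "is_expansion x c"
        by (auto simp: univoque_def)
      have "r > 0" "r < len"
        using ab by (auto simp: r_def)
      have "\<forall>\<^sub>F n in sequentially. len / scale c n < r"
        using inverse_scale_tendsto_0 \<open>r > 0\<close> by (rule order_tendstoD)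
      then have ex: "\<exists>n. len / scale c n < r"
        using eventually_happens' sequentially_bot by blast
      define n where "n = (LEAST n. len / scale c n < r)"
      have n: "len / scale c n < r"
        unfolding n_def using ex by (rule LeastI_ex)
      \<comment> \<open>The cylinder of level \<open>0\<close> is the whole interval, too long to qualify, so there is a
          preceding cylinder, of length at least \<open>r\<close>.\<close>
      then obtain k where k: "n = Suc k"
        using \<open>r < len\<close> by (cases n) auto
      have "\<not> len / scale c k < r"
        using not_less_Least[of k] k n_def by (metis lessI)
      then have "scale c k * r \<le> len"
        by (simp add: field_simps)
      moreover have "q (c k) \<le> qm"
        by (simp add: qbase_def qm_def)
      ultimately have "q (c k) * (scale c k * r) \<le> qm * len"
        using \<open>r > 0\<close> \<open>qm > 1\<close> by (intro mult_mono) (auto simp: less_imp_le)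
      then have "scale c n * r \<le> qm * len"
        by (simp add: k)
      then have "r / (qm * len) \<le> 1 / scale c n"
        using \<open>qm > 1\<close> len_pos by (simp add: field_simps)
      then have "s * (r / (qm * len)) \<le> s * (1 / scale c n)"
        using \<open>s > 0\<close> by (intro mult_left_mono) auto
      then have long: "\<delta> * (b - a) \<le> s / scale c n"
        by (simp add: \<delta>_def r_def field_simps)
      \<comment> \<open>\<open>orbit c n\<close> is affine with slope \<open>scale c n\<close> and maps \<open>u\<close> and \<open>v\<close> to the endpoints of the
          switch region.\<close>
      define y u v where "y = orbit c n x"
        and "u = x + (1 / q1 - y) / scale c n" and "v = x + (len / q0 - y) / scale c n"
      have y: "y \<in> {0..len}"
        using c by (simp add: y_def is_expansion_iff_orbit)
      have "1 / q1 > 0" "len / q0 < len"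
        using q0 q1 len_pos by (auto simp: field_simps)
      then have "- len \<le> 1 / q1 - y" "len / q0 - y \<le> len"
        using y unfolding atLeastAtMost_iff by linarith+
      then have "- len / scale c n \<le> (1 / q1 - y) / scale c n"
        "(len / q0 - y) / scale c n \<le> len / scale c n"
        by (intro divide_right_mono; simp add: less_imp_le)+
      then have "x - r \<le> u" "v \<le> x + r"
        using n by (auto simp: u_def v_def)
      then have "a \<le> u" "v \<le> b"
        using x by (auto simp: m_def r_def field_simps)
      moreover have "v - u = s / scale c n"
        by (simp add: u_def v_def s_def diff_divide_distrib)
      moreover have "z \<notin> univoque" if "z \<in> {u<..<v}" for z
      proof -
        have "orbit c n z = y + scale c n * (z - x)"
          using orbit_diff[of c n z x] by (simp add: y_def)
        then have "orbit c n z \<in> {1 / q1 .. len / q0}"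
          using that scale_pos[of c n] by (auto simp: u_def v_def field_simps)
        then show ?thesis
          using c switch_not_univoque by (meson is_expansion_iff_orbit)
      qed
      ultimately show ?thesis
        using long by (intro exI[of _ u] exI[of _ v]) auto
    qed
  qed
qed

text \<open>
  Finite words are used as indices, rather than pairs of a sequence and a length, to make the union
  countable. They may have arbitrary natural numbers as digits, which is harmless: \<open>orbit\<close> is still
  affine with nonzero slope.
\<close>

definition exceptional :: "real set" where
  "exceptional = (\<Union>w :: nat list. {x. orbit (\<lambda>i. w ! i) (length w) x \<in> univoque})"

lemma orbit_not_univoque:
  assumes "x \<notin> exceptional"
  shows "orbit c n x \<notin> univoque"
proof -
  have "orbit (\<lambda>i. map c [0..<n] ! i) n x = orbit c n x"
    by (rule orbit_cong) simp
  then show ?thesis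
    using assms by (auto simp: exceptional_def dest: spec[of _ "map c [0..<n]"])
qed

lemma negligible_orbit_vimage:
  assumes "negligible S"
  shows "negligible {x. orbit c n x \<in> S}"
proof -
  define h where "h y = (y - orbit c n 0) / scale c n" for y
  have "h differentiable_on S"
    unfolding h_def divide_inverse
    by (intro differentiable_on_mult differentiable_on_diff differentiable_on_const differentiable_on_ident)
  then have "negligible (h ` S)"
    using assms by (intro negligible_differentiable_image_negligible) auto
  moreover have "x = h (orbit c n x)" for x
    using orbit_diff[of c n x 0] by (simp add: h_def)
  then have "{x. orbit c n x \<in> S} \<subseteq> h ` S"
    by blast
  ultimately show ?thesis
    by (rule negligible_subset)
qed

lemma negligible_exceptional: "negligible exceptional"
  unfolding exceptional_def
  by (intro negligible_countable_Union countable_image countableI_type)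
     (auto intro: negligible_orbit_vimage negligible_univoque)

section \<open>Counting the expansions\<close>

abbreviation digit_space :: "(nat \<Rightarrow> nat) topology" where
  "digit_space \<equiv> product_topology (\<lambda>_. discrete_topology {0, 1}) UNIV"

text \<open>
  The next two lemmas say that sequences agreeing with \<open>c\<close> on a finite prefix form a neighbourhood
  basis of \<open>c\<close> in the digit space.
\<close>

lemma openin_cylinder:
  "openin digit_space {c'. (\<forall>i. c' i \<in> {0, 1}) \<and> (\<forall>i<n. c' i = c i)}" if "\<And>i. c i \<in> {0, 1}"
proof -
  have "{c'. (\<forall>i. c' i \<in> {0, 1}) \<and> (\<forall>i<n. c' i = c i)} =
      (\<Pi>\<^sub>E i\<in>UNIV. if i < n then {c i} else {0, 1})"
  proof (intro equalityI subsetI)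
    fix c' assume "c' \<in> (\<Pi>\<^sub>E i\<in>UNIV. if i < n then {c i} else {0, 1})"
    then have "c' i \<in> (if i < n then {c i} else {0, 1})" for i
      by (simp add: PiE_iff)
    then have "c' i \<in> {0, 1} \<and> (i < n \<longrightarrow> c' i = c i)" for i
      using that[of i] by (metis singletonD)
    then show "c' \<in> {c'. (\<forall>i. c' i \<in> {0, 1}) \<and> (\<forall>i<n. c' i = c i)}"
      by blast
  qed (auto simp: PiE_iff)
  moreover have "finite {i. (if i < n then {c i} else {0, 1}) \<noteq> {0, 1::nat}}"
    by (rule finite_subset[of _ "{..<n}"]) auto
  ultimately show ?thesis
    using that by (simp add: openin_PiE_gen)
qed

lemma cylinder_in_open:
  assumes "openin digit_space T" and "c \<in> T"
  obtains n where "\<And>c'. \<lbrakk>\<And>i. c' i \<in> {0, 1}; \<And>i. i < n \<Longrightarrow> c' i = c i\<rbrakk> \<Longrightarrow> c' \<in> T"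
proof -
  obtain W where fin: "finite {i. W i \<noteq> {0, 1::nat}}" and W: "c \<in> Pi\<^sub>E UNIV W" "Pi\<^sub>E UNIV W \<subseteq> T"
    using assms unfolding openin_product_topology_alt by auto
  obtain n where n: "\<And>i. W i \<noteq> {0, 1} \<Longrightarrow> i < n"
    using fin unfolding finite_nat_set_iff_bounded by auto
  show thesis
  proof (rule that)
    fix c' :: "nat \<Rightarrow> nat"
    assume c': "\<And>i. c' i \<in> {0, 1}" "\<And>i. i < n \<Longrightarrow> c' i = c i"
    have "c' i \<in> W i" for i
      using c' n[of i] W(1) by (cases "i < n") (auto simp: PiE_iff)
    then show "c' \<in> T"
      using W(2) by auto
  qed
qed

text \<open>
  Closed: \<open>orbit c n x\<close> depends on the first \<open>n\<close> digits only, which a limit point \<open>c\<close> shares with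
  some expansion. No isolated point: \<open>orbit c n x\<close> is not univoque, so the tail of an expansion \<open>c\<close>
  after \<open>n\<close> digits can be replaced by a different one.
\<close>

lemma expansions_perfect:
  assumes "x \<notin> exceptional"
  shows "digit_space derived_set_of (Q_expansions (q0, q1) x) = Q_expansions (q0, q1) x"
    (is "?X derived_set_of ?E = ?E")
proof (intro equalityI subsetI)
  fix c assume c: "c \<in> ?X derived_set_of ?E"
  then have digits: "\<And>i. c i \<in> {0, 1}"
    by (auto simp: in_derived_set_of PiE_iff)
  have "orbit c n x \<in> {0..len}" for n
  proof -
    have "c \<in> {c'. (\<forall>i. c' i \<in> {0, 1}) \<and> (\<forall>i<n. c' i = c i)}"
      using digits by blast
    moreover have "\<forall>T. c \<in> T \<and> openin ?X T \<longrightarrow> (\<exists>c'. c' \<noteq> c \<and> c' \<in> ?E \<and> c' \<in> T)"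
      using c by (simp only: in_derived_set_of) blast
    ultimately obtain c' where "c' \<in> ?E" "c' \<in> {c'. (\<forall>i. c' i \<in> {0, 1}) \<and> (\<forall>i<n. c' i = c i)}"
      using openin_cylinder[of c n, OF digits] by meson
    then have "is_expansion x c'" "\<And>i. i < n \<Longrightarrow> c' i = c i"
      by (simp_all add: Q_expansions_def)
    then show ?thesis
      using orbit_cong[of n c' c x] by (metis is_expansion_iff_orbit)
  qed
  then show "c \<in> ?E"
    using digits by (simp add: Q_expansions_def is_expansion_iff_orbit)
next
  fix c assume "c \<in> ?E"
  then have c: "is_expansion x c"
    by (simp add: Q_expansions_def)
  then have digits: "\<And>i. c i \<in> {0, 1}"
    by (simp add: is_expansion_iff_orbit)
  show "c \<in> ?X derived_set_of ?E"
    unfolding in_derived_set_of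
  proof (intro conjI allI impI)
    show "c \<in> topspace ?X"
      using digits by (simp add: PiE_iff)
    fix T assume "c \<in> T \<and> openin ?X T"
    then obtain n where n: "\<And>c'. \<lbrakk>\<And>i. c' i \<in> {0, 1}; \<And>i. i < n \<Longrightarrow> c' i = c i\<rbrakk> \<Longrightarrow> c' \<in> T"
      using cylinder_in_open[of T c] by blast
    have "orbit c n x \<notin> univoque"
      using assms by (rule orbit_not_univoque)
    then obtain d where d: "is_expansion (orbit c n x) d" "d \<noteq> (\<lambda>i. c (n + i))"
      using is_expansion_drop[OF c, of n] unfolding univoque_def by blast
    have "is_expansion x (splice c n d)"
      using digits d(1) by (rule is_expansion_splice)
    moreover from this have "splice c n d \<in> T"
      using n by (simp add: is_expansion_iff_orbit)
    moreover have "splice c n d \<noteq> c"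
      using d(2) by (metis splice_simps(2) ext)
    ultimately show "\<exists>y. y \<noteq> c \<and> y \<in> ?E \<and> y \<in> T"
      by (auto simp: Q_expansions_def)
  qed
qed

text \<open>
  The upper bound holds for any set of digit sequences; the lower bound is the theorem that nonempty
  perfect sets in locally compact Hausdorff spaces are at least as large as the continuum.
\<close>

lemma expansions_eqpoll_real:
  assumes "x \<in> {0..len}" and "x \<notin> exceptional"
  shows "Q_expansions (q0, q1) x \<approx> (UNIV :: real set)"
proof (rule lepoll_antisym)
  let ?E = "Q_expansions (q0, q1) x"
  have "inj_on (\<lambda>c. {i. c i = 1}) ?E"
  proof (rule inj_onI, rule ext)
    fix c d i assume "c \<in> ?E" "d \<in> ?E" and eq: "{i. c i = 1} = {i. d i = 1}"
    then have "c i \<in> {0, 1}" "d i \<in> {0, 1}"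
      by (simp_all add: Q_expansions_def is_Q_expansion_def)
    then show "c i = d i"
      using eq by (metis (mono_tags) insertE mem_Collect_eq singletonD)
  qed
  then have "?E \<lesssim> (UNIV :: nat set set)"
    unfolding lepoll_def by blast
  then show "?E \<lesssim> (UNIV :: real set)"
    using nat_sets_eqpoll_reals lepoll_trans2 by blast
  show "(UNIV :: real set) \<lesssim> ?E"
  proof (rule lepoll_perfect_set)
    show "completely_metrizable_space digit_space \<or>
        locally_compact_space digit_space \<and> Hausdorff_space digit_space"
      by (intro disjI2 conjI compact_imp_locally_compact_space)
         (simp_all add: compact_space_product_topology Hausdorff_space_product_topology
            compact_space_discrete_topology)
    show "digit_space derived_set_of ?E = ?E"
      using assms(2) by (rule expansions_perfect)
    show "?E \<noteq> {}"
      using ex_expansion[OF assms(1)] by (simp add: Q_expansions_def)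
  qed
qed

end

theorem theorem1p5:
  fixes q0 q1 :: real
  assumes "q0 > 1" and "q1 > 1"
    and "q0 + q1 > q0 * q1"
  shows "AE x in lebesgue_on (I_Q (q0, q1)).
           Q_expansions (q0, q1) x \<approx> (UNIV :: real set)"
proof -
  interpret overlapping_bases q0 q1
    by unfold_locales fact+
  have "AE x in lebesgue. x \<notin> exceptional"
    using negligible_exceptional by (intro AE_not_in) (simp add: negligible_iff_null_sets)
  then have "AE x in lebesgue. x \<in> I_Q (q0, q1) \<longrightarrow>
      Q_expansions (q0, q1) x \<approx> (UNIV :: real set)"
    by eventually_elim (use expansions_eqpoll_real in \<open>simp add: I_Q_def len_def\<close>)
  then show ?thesis
    by (subst AE_restrict_space_iff) (simp_all add: I_Q_def)
qed

end
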